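(* Let $m>0$. There is a unique $R^*>m/2$ satisfying $$\log\sqrt{\frac{2R^*}{m}}=\frac{2R^*+m}{2R^*-m},$$ and the annular domain $\Sigma_0(R)=\Sigma_0\cap\{|x|\le R\}$ of the plane through the origin is stable (i.e. $Q(u,u)\ge 0$ for every smooth $u$ on $\Sigma_0(R)$ vanishing on $\{|x|=R\}$) if and only if $m/2<R\le R^*$; that is, $\Sigma_0(R^* )$ is the maximal annular domain of stability containing the horizon. (Numerically $R^*\approx 5.5\,m$.)
   Context: For $m>0$ let $M=\{x\in\mathbb R^3: |x|\ge m/2\}$ with metric $g=(1+\frac{m}{2|x|})^4\delta$, $\delta$ the Euclidean metric, and $\Sigma_0=\{x\in M:x_3=0\}$; $|x|$ denotes the Euclidean norm. For smooth $u$ on $\Sigma_0(R)$, since $\Sigma_0$ and $\partial M$ are totally geodesic, the second variation of $g$-area for variations tangential along $\partial M$ is $Q(u,u)=\int_{\Sigma_0(R)}\big(|\nabla_g u|_g^2-\mathrm{Ric}_g(N,N)u^2\big)dA_g$, with $N$ a unit normal to $\Sigma_0$. *)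

theory Defs
  imports "HOL-Analysis.Analysis"
begin

definition pd :: "(real^'n \<Rightarrow> real) \<Rightarrow> real^'n \<Rightarrow> 'n \<Rightarrow> real" where
  "pd f x i = deriv (\<lambda>t. f (x + t *\<^sub>R axis i 1)) 0"

fun iter_pd :: "(real^'n \<Rightarrow> real) \<Rightarrow> 'n list \<Rightarrow> real^'n \<Rightarrow> real" where
  "iter_pd f [] = f"
| "iter_pd f (i # is) = (\<lambda>x. pd (iter_pd f is) x i)"

definition smooth_on_set :: "(real^'n::finite) set \<Rightarrow> (real^'n \<Rightarrow> real) \<Rightarrow> bool" where
  "smooth_on_set S f \<longleftrightarrow> (\<exists>U. open U \<and> S \<subseteq> U \<and> (\<forall>is. iter_pd f is differentiable_on U))"

text \<open>A Riemannian metric on (an open subset of) R^3 given by its component matrix field.\<close>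
type_synonym metric3 = "real^3 \<Rightarrow> real^3^3"

definition christoffel :: "metric3 \<Rightarrow> real^3 \<Rightarrow> 3 \<Rightarrow> 3 \<Rightarrow> 3 \<Rightarrow> real" where
  "christoffel G x k i j =
     (1/2) * (\<Sum>l\<in>UNIV. matrix_inv (G x) $ k $ l *
        (pd (\<lambda>y. G y $ j $ l) x i + pd (\<lambda>y. G y $ i $ l) x j - pd (\<lambda>y. G y $ i $ j) x l))"

definition ricci :: "metric3 \<Rightarrow> real^3 \<Rightarrow> real^3^3" where
  "ricci G x = (\<chi> i j. (\<Sum>k\<in>UNIV.
      pd (\<lambda>y. christoffel G y k i j) x k - pd (\<lambda>y. christoffel G y k i k) x j
      + (\<Sum>l\<in>UNIV. christoffel G x k k l * christoffel G x l i j
                   - christoffel G x k j l * christoffel G x l i k)))"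

definition ric_apply :: "metric3 \<Rightarrow> real^3 \<Rightarrow> real^3 \<Rightarrow> real" where
  "ric_apply G x v = v \<bullet> (ricci G x *v v)"

definition schw_metric :: "real \<Rightarrow> metric3" where
  "schw_metric m x = ((1 + m / (2 * norm x)) ^ 4) *\<^sub>R mat 1"

definition emb :: "real^2 \<Rightarrow> real^3" where
  "emb p = vector [p $ 1, p $ 2, 0]"

text \<open>Unit normal to the level set {x_3 = 0}: g-gradient of x_3 normalised.\<close>
definition unit_normal :: "metric3 \<Rightarrow> real^3 \<Rightarrow> real^3" where
  "unit_normal G x = (1 / sqrt (axis 3 1 \<bullet> (matrix_inv (G x) *v axis 3 1)))
                       *\<^sub>R (matrix_inv (G x) *v axis 3 1)"

definition induced :: "metric3 \<Rightarrow> real^2 \<Rightarrow> real^2^2" where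
  "induced G p = (\<chi> a b. emb (axis a 1) \<bullet> (G (emb p) *v emb (axis b 1)))"

definition Sigma0 :: "real \<Rightarrow> real \<Rightarrow> (real^2) set" where
  "Sigma0 m R = {p. m / 2 \<le> norm p \<and> norm p \<le> R}"

definition grad2 :: "(real^2 \<Rightarrow> real) \<Rightarrow> real^2 \<Rightarrow> real^2" where
  "grad2 u p = (\<chi> a. pd u p a)"

definition Qform :: "real \<Rightarrow> real \<Rightarrow> (real^2 \<Rightarrow> real) \<Rightarrow> real" where
  "Qform m R u = integral (Sigma0 m R) (\<lambda>p.
      (grad2 u p \<bullet> (matrix_inv (induced (schw_metric m) p) *v grad2 u p)
       - ric_apply (schw_metric m) (emb p) (unit_normal (schw_metric m) (emb p)) * (u p)^2)
      * sqrt (det (induced (schw_metric m) p)))"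

definition stable :: "real \<Rightarrow> real \<Rightarrow> bool" where
  "stable m R \<longleftrightarrow> (\<forall>u. smooth_on_set (Sigma0 m R) u \<and> (\<forall>p. norm p = R \<longrightarrow> u p = 0)
                       \<longrightarrow> Qform m R u \<ge> 0)"

end

theory Submission
  imports Defs
begin

text \<open>
  The metric is conformally flat and the Dirichlet energy of a surface is conformally invariant, so
  \<open>Q(u,u)\<close> is the integral of \<open>|\<nabla>u|\<^sup>2 - 4m / (r (2r + m)\<^sup>2) u\<^sup>2\<close> over a Euclidean annulus.
  In the coordinates \<open>r = (m/2) exp (2t)\<close> and \<open>\<theta>\<close> it dominates, ray by ray, one half of the
  integral of \<open>v'\<^sup>2 - 2 (1 - tanh\<^sup>2 t) v\<^sup>2\<close> over \<open>[0, T]\<close>, with equality for radial \<open>u\<close>. The Jacobi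
  equation \<open>w'' + 2 (1 - tanh\<^sup>2 t) w = 0\<close> has the solutions \<open>tanh t\<close> and \<open>1 - t tanh t\<close>. If
  \<open>T tanh T \<le> 1\<close>, the latter is positive on \<open>[0, T)\<close> and a Riccati argument gives stability; if
  \<open>T tanh T > 1\<close>, the combination \<open>1 - t tanh t + c tanh t\<close> vanishing at \<open>T\<close> has \<open>c > 0\<close> and integral
  \<open>-c\<close>. The equation for \<open>R\<^sup>*\<close> is \<open>T tanh T = 1\<close>.
\<close>

subsection \<open>The one-dimensional form on a ray\<close>

text \<open>With \<open>t = ln (2 |x| / m) / 2\<close>, the radial Jacobi equation of \<open>\<Sigma>\<^sub>0\<close> reads
  \<open>w'' + 2 (1 - tanh\<^sup>2 t) w = 0\<close>. These are its solutions with \<open>w 0 = 1\<close>; the parameter is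
  \<open>c = w' 0\<close>, so \<open>c = 0\<close> is the free boundary condition at the horizon.\<close>
definition jacobi_sol :: "real \<Rightarrow> real \<Rightarrow> real" where
  "jacobi_sol c t = 1 + (c - t) * tanh t"

definition jacobi_sol' :: "real \<Rightarrow> real \<Rightarrow> real" where
  "jacobi_sol' c t = (c - t) * (1 - tanh t ^ 2) - tanh t"

lemma jacobi_sol_has_derivative:
  "(jacobi_sol c has_real_derivative jacobi_sol' c t) (at t within S)"
  unfolding jacobi_sol_def jacobi_sol'_def
  by (auto intro!: derivative_eq_intros simp: algebra_simps)

lemma jacobi_sol'_has_derivative:
  "(jacobi_sol' c has_real_derivative - 2 * (1 - tanh t ^ 2) * jacobi_sol c t) (at t within S)"
  unfolding jacobi_sol_def jacobi_sol'_def
  by (auto intro!: derivative_eq_intros simp: algebra_simps power2_eq_square)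

text \<open>This monotonicity keeps \<open>1 - t tanh t\<close> positive before its first zero and
  makes the critical radius unique.\<close>

lemma x_tanh_strict_mono:
  fixes x y :: real
  assumes "0 \<le> x" "x < y"
  shows "x * tanh x < y * tanh y"
proof -
  have "x * tanh x \<le> x * tanh y"
    using assms by (intro mult_left_mono) auto
  also have "\<dots> < y * tanh y"
    using assms by (intro mult_strict_right_mono) auto
  finally show ?thesis .
qed

text \<open>A positive solution \<open>w\<close> of the Jacobi equation makes the form a square plus
  boundary terms. Only the term at 0 survives, it is proportional to the initial slope of
  \<open>w\<close>, and that slope may be taken arbitrarily small.\<close>

lemma ray_form_nonneg:
  fixes v v' :: "real \<Rightarrow> real"
  assumes T: "0 < T" "T * tanh T \<le> 1"
    and v: "\<And>t. t \<in> {0..T} \<Longrightarrow> (v has_real_derivative v' t) (at t within {0..T})"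
    and v': "continuous_on {0..T} v'"
    and "v T = 0"
  shows "0 \<le> integral {0..T} (\<lambda>t. (v' t)\<^sup>2 - 2 * (1 - tanh t ^ 2) * (v t)\<^sup>2)" (is "0 \<le> ?I")
proof -
  have contv: "continuous_on {0..T} v"
    using v DERIV_continuous_on by blast
  have bound: "- \<epsilon> * (v 0)\<^sup>2 \<le> ?I" if "\<epsilon> > 0" for \<epsilon>
  proof -
    \<comment> \<open>Completing the square with \<open>w' / w\<close>. The solution for \<open>\<epsilon> = 0\<close> vanishes at \<open>T\<close> in the
        critical case; a slope \<open>\<epsilon> > 0\<close> keeps \<open>w\<close> positive at the cost of the boundary term.\<close>
    let ?w = "jacobi_sol \<epsilon>" and ?w' = "jacobi_sol' \<epsilon>"
    let ?f = "\<lambda>t. (v' t)\<^sup>2 - 2 * (1 - tanh t ^ 2) * (v t)\<^sup>2"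
    have wpos: "?w t > 0" if t: "t \<in> {0..T}" for t
    proof (cases "t = 0")
      case False
      then have "0 < \<epsilon> * tanh t" using t \<open>\<epsilon> > 0\<close> by auto
      moreover have "t * tanh t \<le> T * tanh T"
        using x_tanh_strict_mono[of t T] t by (cases "t = T") auto
      ultimately show ?thesis using T by (simp add: jacobi_sol_def algebra_simps)
    qed (simp add: jacobi_sol_def)
    \<comment> \<open>The quotient \<open>q = w'/w\<close> solves the Riccati equation
      \<open>q' = - 2 (1 - tanh^2 t) - q^2\<close>, so differentiating \<open>v^2 q\<close> produces
      exactly the integrand minus a square.\<close>
    have der: "((\<lambda>t. (v t)\<^sup>2 * (?w' t / ?w t)) has_real_derivative
        ?f t - (v' t - v t * (?w' t / ?w t))\<^sup>2) (at t within {0..T})" if t: "t \<in> {0..T}" for t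
      using wpos[OF t]
      by (auto intro!: derivative_eq_intros v[OF t] jacobi_sol_has_derivative jacobi_sol'_has_derivative
          simp: field_simps power2_eq_square)
    have "((\<lambda>t. ?f t - (v' t - v t * (?w' t / ?w t))\<^sup>2) has_integral
        (v T)\<^sup>2 * (?w' T / ?w T) - (v 0)\<^sup>2 * (?w' 0 / ?w 0)) {0..T}"
      using der T by (intro fundamental_theorem_of_calculus)
        (auto simp: has_real_derivative_iff_has_vector_derivative)
    moreover have "(v T)\<^sup>2 * (?w' T / ?w T) - (v 0)\<^sup>2 * (?w' 0 / ?w 0) = - \<epsilon> * (v 0)\<^sup>2"
      using \<open>v T = 0\<close> by (simp add: jacobi_sol_def jacobi_sol'_def)
    ultimately have "((\<lambda>t. ?f t - (v' t - v t * (?w' t / ?w t))\<^sup>2) has_integral - \<epsilon> * (v 0)\<^sup>2) {0..T}"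
      by simp
    moreover have "?f integrable_on {0..T}"
      by (intro integrable_continuous_real continuous_intros contv v') auto
    ultimately show ?thesis
      by (rule has_integral_le[OF _ integrable_integral]) auto
  qed
  show ?thesis
  proof (cases "v 0 = 0")
    case True
    then show ?thesis using bound[of 1] by simp
  next
    case False
    show ?thesis
    proof (rule ccontr)
      assume "\<not> 0 \<le> ?I"
      \<comment> \<open>For this slope the bound reads \<open>?I / 2 \<le> ?I\<close>, which is
        impossible for negative \<open>?I\<close>.\<close>
      then show False
        using bound[of "- ?I / (2 * (v 0)\<^sup>2)"] False by (simp add: field_simps)
    qed
  qed
qed

text \<open>Integration by parts: by the Jacobi equation the integrand is the derivative of
  \<open>w w'\<close>. The end \<open>T\<close> contributes nothing, and at 0 the values are
  \<open>w = 1\<close> and \<open>w' = c\<close>.\<close>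

lemma jacobi_sol_form:
  assumes "0 < T" "jacobi_sol c T = 0"
  shows "((\<lambda>t. (jacobi_sol' c t)\<^sup>2 - 2 * (1 - tanh t ^ 2) * (jacobi_sol c t)\<^sup>2) has_integral - c) {0..T}"
proof -
  have "((\<lambda>t. jacobi_sol c t * jacobi_sol' c t) has_real_derivative
      (jacobi_sol' c t)\<^sup>2 - 2 * (1 - tanh t ^ 2) * (jacobi_sol c t)\<^sup>2) (at t within {0..T})" for t
    by (rule derivative_eq_intros jacobi_sol_has_derivative jacobi_sol'_has_derivative refl)+
      (simp add: algebra_simps power2_eq_square)
  then have "((\<lambda>t. (jacobi_sol' c t)\<^sup>2 - 2 * (1 - tanh t ^ 2) * (jacobi_sol c t)\<^sup>2) has_integral
      jacobi_sol c T * jacobi_sol' c T - jacobi_sol c 0 * jacobi_sol' c 0) {0..T}"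
    using assms by (intro fundamental_theorem_of_calculus)
        (auto simp: has_real_derivative_iff_has_vector_derivative)
  then show ?thesis
    using assms by (simp add: jacobi_sol_def jacobi_sol'_def)
qed

section \<open>The equation for the critical radius\<close>

lemma tanh_half_ln:
  fixes m r :: real
  assumes "m > 0" "r > 0"
  shows "tanh (ln (2 * r / m) / 2) = (2 * r - m) / (2 * r + m)"
proof -
  have "ln (2 * r / m) / 2 = ln (sqrt (2 * r / m))"
    using assms by (simp add: ln_sqrt)
  then have "tanh (ln (2 * r / m) / 2) = (2 * r / m - 1) / (2 * r / m + 1)"
    using assms by (simp add: tanh_ln_real)
  also have "\<dots> = (2 * r - m) / (2 * r + m)"
    using assms by (simp add: divide_simps)
  finally show ?thesis .
qed

lemma critical_radius_iff:
  fixes m R :: real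
  assumes "m > 0" "R > m / 2"
  shows "ln (sqrt (2 * R / m)) = (2 * R + m) / (2 * R - m) \<longleftrightarrow>
         ln (sqrt (2 * R / m)) * tanh (ln (sqrt (2 * R / m))) = 1"
proof -
  have "ln (sqrt (2 * R / m)) = ln (2 * R / m) / 2"
    using assms by (simp add: ln_sqrt)
  then have "tanh (ln (sqrt (2 * R / m))) = (2 * R - m) / (2 * R + m)"
    using tanh_half_ln[of m R] assms by (simp only:)
  moreover have "x = a / b \<longleftrightarrow> x * (b / a) = 1" if "a > 0" "b > 0" for x a b :: real
    using that by (auto simp: field_simps)
  ultimately show ?thesis
    using assms by simp
qed

text \<open>Intermediate value theorem on \<open>[0, 2]\<close>. Since
  \<open>tanh 2 = (1 - exp (-4)) / (1 + exp (-4))\<close>, the inequality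
  \<open>2 tanh 2 \<ge> 1\<close> amounts to \<open>exp (-4) \<le> 1/3\<close>, for which the crude
  bound \<open>exp 4 \<ge> 5\<close> is enough.\<close>

lemma ex_x_tanh_eq_1: "\<exists>t. t > 0 \<and> t * tanh t = (1::real)"
proof -
  have "exp (4::real) \<ge> 1 + 4" by (rule exp_ge_add_one_self)
  then have "exp (-4::real) \<le> 1/5"
    by (simp add: exp_minus field_simps)
  then have "(2::real) * tanh 2 \<ge> 1"
    by (simp add: tanh_real_altdef pos_le_divide_eq add_pos_pos)
  moreover have "continuous_on {0..2} (\<lambda>t::real. t * tanh t)"
    by (intro continuous_intros) auto
  ultimately obtain t :: real where "0 \<le> t" "t * tanh t = 1"
    using IVT'[of "\<lambda>t::real. t * tanh t" 0 1 2] by auto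
  moreover from this have "t > 0" by (cases "t = 0") auto
  ultimately show ?thesis by blast
qed

subsection \<open>Curvature of the Schwarzschild metric\<close>

lemma matrix_inv_scaled_identity:
  fixes c :: real
  assumes "c \<noteq> 0"
  shows "matrix_inv (c *\<^sub>R mat 1 :: real^'n^'n) = (1 / c) *\<^sub>R mat 1"
proof -
  let ?A = "c *\<^sub>R mat 1 :: real^'n^'n" and ?B = "(1 / c) *\<^sub>R mat 1 :: real^'n^'n"
  have AB: "?A ** ?B = mat 1" "?B ** ?A = mat 1"
    using assms by (simp_all add: matrix_scalar_ac flip: scalar_matrix_assoc)
  \<comment> \<open>\<open>matrix_inv\<close> is a Hilbert choice: an inverse must be exhibited
    before the chosen one is known to be an inverse, and cancelling with \<open>?B\<close> then
    identifies it.\<close>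
  then have "\<exists>B. ?A ** B = mat 1 \<and> B ** ?A = mat 1" by blast
  then have "?A ** matrix_inv ?A = mat 1"
    unfolding matrix_inv_def by (rule someI_ex[THEN conjunct1])
  then have "?B ** (?A ** matrix_inv ?A) = ?B" by simp
  then show ?thesis by (simp add: matrix_mul_assoc AB)
qed

section \<open>Partial derivatives along coordinate lines\<close>

lemma pd_eqI:
  "((\<lambda>t. f (x + t *\<^sub>R axis i 1)) has_real_derivative D) (at 0) \<Longrightarrow> pd f x i = D"
  unfolding pd_def by (rule DERIV_imp_deriv)

lemma has_derivative_imp_line:
  assumes "(f has_derivative f') (at x)"
  shows "((\<lambda>t. f (x + t *\<^sub>R v)) has_real_derivative f' v) (at 0)"
proof -
  have "((\<lambda>t::real. x + t *\<^sub>R v) has_derivative (\<lambda>t. t *\<^sub>R v)) (at 0)"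
    by (auto intro!: derivative_eq_intros)
  then have "((\<lambda>t. f (x + t *\<^sub>R v)) has_derivative (\<lambda>t. f' (t *\<^sub>R v))) (at 0)"
    using assms by (intro has_derivative_compose[of "\<lambda>t. x + t *\<^sub>R v" _ 0 UNIV f f']) simp_all
  moreover have "(\<lambda>t. f' (t *\<^sub>R v)) = (*) (f' v)"
    using has_derivative_linear[OF assms] by (auto simp: fun_eq_iff linear_cmul)
  ultimately show ?thesis
    by (simp add: has_field_derivative_def)
qed

lemma norm_has_line_derivative:
  fixes x :: "real^'n"
  assumes "x \<noteq> 0"
  shows "((\<lambda>t. norm (x + t *\<^sub>R axis i 1)) has_real_derivative x $ i / norm x) (at 0)"
proof -
  have "(norm has_derivative (\<lambda>h. h \<bullet> sgn x)) (at x)"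
    using assms by (rule has_derivative_norm)
  from has_derivative_imp_line[OF this, of "axis i 1"] show ?thesis
    by (simp add: inner_axis' sgn_vec_def inverse_eq_divide)
qed

text \<open>A partial derivative depends only on the germ of the function. This allows formulas that
  hold only away from the origin to be differentiated again.\<close>

lemma pd_cong_open:
  assumes "open U" "x \<in> U" "\<And>y. y \<in> U \<Longrightarrow> f y = g y"
  shows "pd f x i = pd g x i"
proof -
  have "continuous_on UNIV (\<lambda>t::real. x + t *\<^sub>R axis i 1)"
    by (intro continuous_intros)
  then have "open ((\<lambda>t::real. x + t *\<^sub>R axis i 1) -` U)"
    using assms(1) by (simp add: continuous_on_open_vimage)
  then have "\<forall>\<^sub>F t in nhds 0. (x + t *\<^sub>R axis i 1) \<in> U"
    using assms(2) eventually_nhds_in_open[of "(\<lambda>t::real. x + t *\<^sub>R axis i 1) -` U" 0] by simp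
  then have "\<forall>\<^sub>F t in nhds 0. f (x + t *\<^sub>R axis i 1) = g (x + t *\<^sub>R axis i 1)"
    by eventually_elim (use assms(3) in auto)
  then show ?thesis
    unfolding pd_def by (rule deriv_cong_ev) simp
qed

text \<open>The partial derivative \<open>\<partial>\<^sub>i f\<close>, where the metric is written as \<open>exp (2 f) \<delta>\<close>.\<close>
definition dlog_factor :: "real \<Rightarrow> real^3 \<Rightarrow> 3 \<Rightarrow> real" where
  "dlog_factor m x i = - 2 * m * x $ i / ((norm x)\<^sup>2 * (2 * norm x + m))"

lemma schw_metric_nth:
  "schw_metric m x $ i $ j = (if i = j then (1 + m / (2 * norm x)) ^ 4 else 0)"
  by (simp add: schw_metric_def mat_def)

lemma pd_schw_factor:
  assumes "m > 0" "x \<noteq> (0 :: real^3)"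
  shows "pd (\<lambda>y. (1 + m / (2 * norm y)) ^ 4) x i = 2 * (1 + m / (2 * norm x)) ^ 4 * dlog_factor m x i"
proof (rule pd_eqI)
  define r where "r = norm x"
  have r: "r > 0" using assms by (simp add: r_def)
  have ne: "2 * r + m \<noteq> 0" using assms r by simp
  have "((\<lambda>t. (1 + m / (2 * norm (x + t *\<^sub>R axis i 1))) ^ 4) has_real_derivative
      4 * (1 + m / (2 * r)) ^ 3 * (- m * (x $ i / r) / (2 * r\<^sup>2))) (at 0)"
    using r
    by (auto intro!: derivative_eq_intros norm_has_line_derivative[OF assms(2)]
        simp: r_def field_simps power2_eq_square)
  moreover have "4 * (1 + m / (2 * r)) ^ 3 * (- m * (x $ i / r) / (2 * r\<^sup>2)) =
      2 * (1 + m / (2 * r)) ^ 4 * dlog_factor m x i"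
  proof -
    have "(1 + m / (2 * r)) ^ 4 = (1 + m / (2 * r)) ^ 3 * ((2 * r + m) / (2 * r))"
      using r by (simp add: field_simps eval_nat_numeral)
    then show ?thesis
      using r ne by (simp add: dlog_factor_def divide_simps power2_eq_square flip: r_def)
  qed
  ultimately show "((\<lambda>t. (1 + m / (2 * norm (x + t *\<^sub>R axis i 1))) ^ 4) has_real_derivative
      2 * (1 + m / (2 * norm x)) ^ 4 * dlog_factor m x i) (at 0)"
    by (simp add: r_def)
qed

lemma pd_zero: "pd (\<lambda>y. 0) x i = 0"
  by (rule pd_eqI) simp

text \<open>These are the Christoffel symbols of a conformally flat metric
  \<open>exp (2 f) \<delta>\<close>: the factor in the derivatives of the metric cancels against the
  one in its inverse, leaving only first derivatives of \<open>f\<close>.\<close>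

lemma schw_christoffel:
  assumes "m > 0" "x \<noteq> 0"
  shows "christoffel (schw_metric m) x k i j =
    (if j = k then dlog_factor m x i else 0) + (if i = k then dlog_factor m x j else 0)
    - (if i = j then dlog_factor m x k else 0)"
proof -
  let ?c = "(1 + m / (2 * norm x)) ^ 4"
  have c: "?c > 0" using assms by (intro zero_less_power add_pos_nonneg) auto
  have inv: "matrix_inv (schw_metric m x) $ k $ l = (if k = l then 1 / ?c else 0)" for l
    unfolding schw_metric_def using c by (subst matrix_inv_scaled_identity) (auto simp: mat_def)
  have pd: "pd (\<lambda>y. schw_metric m y $ a $ b) x l = (if a = b then 2 * ?c * dlog_factor m x l else 0)" for a b l
    using pd_schw_factor[OF assms] by (simp add: schw_metric_nth pd_zero)
  show ?thesis
    unfolding christoffel_def inv pd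
    using c by (simp add: if_distrib[of "\<lambda>z. z * _"] sum.delta' field_simps cong: if_cong)
qed

text \<open>Only the pure second derivatives of the logarithmic factor are computed, since no mixed
  ones occur in the 33-component of the Ricci tensor.\<close>

lemma dlog_factor_line_derivative:
  assumes "m > 0" "x \<noteq> (0 :: real^3)"
  shows "((\<lambda>t. dlog_factor m (x + t *\<^sub>R axis i 1) i) has_real_derivative
     2 * m * (x $ i)\<^sup>2 * (6 * norm x + 2 * m) / ((norm x)\<^sup>2 * (2 * norm x + m))\<^sup>2
     - 2 * m / ((norm x)\<^sup>2 * (2 * norm x + m))) (at 0)"
proof -
  define D where "D = (\<lambda>t. (norm (x + t *\<^sub>R axis i 1))\<^sup>2 * (2 * norm (x + t *\<^sub>R axis i 1) + m))"
  have r: "norm x > 0" using assms by simp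
  have D0: "D 0 = (norm x)\<^sup>2 * (2 * norm x + m)" "D 0 > 0"
    using assms by (auto simp: D_def add_pos_pos)
  have dD: "(D has_real_derivative (6 * norm x + 2 * m) * x $ i) (at 0)"
    unfolding D_def using r
    by (auto intro!: derivative_eq_intros norm_has_line_derivative[OF assms(2)]
        simp: field_simps power2_eq_square)
  have "((\<lambda>t. - 2 * m * (x $ i + t) / D t) has_real_derivative
     2 * m * (x $ i)\<^sup>2 * (6 * norm x + 2 * m) / (D 0)\<^sup>2 - 2 * m / D 0) (at 0)"
    using D0(2) by (auto intro!: derivative_eq_intros dD simp: field_simps power2_eq_square)
  then show ?thesis
    unfolding D0 by (simp add: dlog_factor_def D_def)
qed

lemma schw_ricci_33:
  assumes "m > 0" "x \<noteq> 0" "x $ 3 = 0"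
  shows "ricci (schw_metric m) x $ 3 $ 3 = 4 * m / (norm x * (2 * norm x + m)\<^sup>2)"
proof -
  let ?f = "dlog_factor m"
  define r where "r = norm x"
  define D where "D = r\<^sup>2 * (2 * r + m)"
  have r: "r > 0" "2 * r + m > 0" using assms by (simp_all add: r_def add_pos_pos)
  have D: "D > 0" using r by (simp add: D_def)
  have cong: "pd (\<lambda>y. christoffel (schw_metric m) y k i j) x l =
     pd (\<lambda>y. (if j = k then ?f y i else 0) + (if i = k then ?f y j else 0)
    - (if i = j then ?f y k else 0)) x l" for k i j l
    by (rule pd_cong_open[of "- {0}"]) (use assms schw_christoffel[OF assms(1)] in auto)
  let ?a = "\<lambda>k. 2 * m * (x $ k)\<^sup>2 * (6 * r + 2 * m) / D\<^sup>2 - 2 * m / D"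
  have pd: "pd (\<lambda>y. ?f y k) x k = ?a k" "pd (\<lambda>y. - ?f y k) x k = - ?a k" for k
    unfolding D_def r_def
    by (rule pd_eqI dlog_factor_line_derivative[OF assms(1,2)] DERIV_minus)+
  have f: "?f x k = - 2 * m * x $ k / D" for k
    by (simp add: dlog_factor_def D_def r_def)
  \<comment> \<open>This is the conformal change formula in dimension 3,
    \<open>Ric_33 = - f_33 + f_3^2 - \<Delta> f - |\<nabla> f|^2\<close>, where
    \<open>f_3 = 0\<close> on the plane.\<close>
  have "ricci (schw_metric m) x $ 3 $ 3 = - ?a 1 - ?a 2 - 2 * ?a 3 - (?f x 1)\<^sup>2 - (?f x 2)\<^sup>2"
    unfolding ricci_def using assms(3)
    by (simp add: sum_3 cong pd schw_christoffel[OF assms(1,2)] f power2_eq_square ac_simps)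
  also have "\<dots> = (8 * m * D - 2 * m * ((x $ 1)\<^sup>2 + (x $ 2)\<^sup>2) * (6 * r + 4 * m)) / D\<^sup>2"
    using D assms(3) by (simp add: f field_simps power2_eq_square)
  also have "(x $ 1)\<^sup>2 + (x $ 2)\<^sup>2 = r\<^sup>2"
    using assms(3) by (simp add: r_def norm_vec_def L2_set_def sum_3 sum_nonneg)
  also have "8 * m * D - 2 * m * r\<^sup>2 * (6 * r + 4 * m) = 4 * m * r ^ 3"
    by (simp add: D_def algebra_simps power2_eq_square power3_eq_cube)
  also have "4 * m * r ^ 3 / D\<^sup>2 = 4 * m / (r * (2 * r + m)\<^sup>2)"
    using r by (simp add: D_def power_mult_distrib divide_simps) (simp add: eval_nat_numeral)
  finally show ?thesis by (simp add: r_def)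
qed

section \<open>The second variation as a Euclidean integral\<close>

lemma norm_emb: "norm (emb p) = norm p"
  by (simp add: emb_def norm_vec_def L2_set_def sum_2 sum_3)

text \<open>With conformal factor \<open>\<phi>^4\<close>, the inverse induced metric contributes
  \<open>\<phi>^-4\<close> to the gradient term, and the unit normal \<open>\<phi>^-2 e_3\<close>
  contributes the same weight to the Ricci term. Both cancel against the area density
  \<open>\<phi>^4\<close>.\<close>

lemma Qform_integrand:
  assumes m: "m > 0" and p: "p \<noteq> (0 :: real^2)"
  shows "(grad2 u p \<bullet> (matrix_inv (induced (schw_metric m) p) *v grad2 u p)
       - ric_apply (schw_metric m) (emb p) (unit_normal (schw_metric m) (emb p)) * (u p)^2)
      * sqrt (det (induced (schw_metric m) p))
    = (norm (grad2 u p))\<^sup>2 - 4 * m / (norm p * (2 * norm p + m)\<^sup>2) * (u p)\<^sup>2"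
proof -
  define \<phi> where "\<phi> = 1 + m / (2 * norm p)"
  have \<phi>: "\<phi> > 0" using m by (auto simp: \<phi>_def intro: add_pos_nonneg)
  have G: "schw_metric m (emb p) = \<phi> ^ 4 *\<^sub>R mat 1"
    by (simp add: schw_metric_def norm_emb \<phi>_def)
  have ind: "induced (schw_metric m) p = \<phi> ^ 4 *\<^sub>R mat 1"
    unfolding induced_def G
    by (simp add: scaleR_matrix_vector_assoc[symmetric])
      (simp add: vec_eq_iff forall_2 emb_def axis_def mat_def inner_vec_def sum_3)
  have "emb p \<noteq> 0" using p norm_emb[of p] by auto
  then have ric: "ricci (schw_metric m) (emb p) $ 3 $ 3 = 4 * m / (norm p * (2 * norm p + m)\<^sup>2)"
    using schw_ricci_33[OF m, of "emb p"] by (simp add: norm_emb) (simp add: emb_def)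
  have Ginv: "matrix_inv (schw_metric m (emb p)) *v axis 3 1 = (1 / \<phi> ^ 4) *\<^sub>R axis 3 1"
    unfolding G using \<phi> by (simp add: matrix_inv_scaled_identity flip: scaleR_matrix_vector_assoc)
  have sq: "sqrt (\<phi> ^ 4) = \<phi>\<^sup>2"
    by (rule real_sqrt_unique) auto
  have "\<phi>\<^sup>2 / \<phi> ^ 4 = 1 / \<phi>\<^sup>2"
    using \<phi> by (simp add: divide_simps flip: power_add)
  then have N: "unit_normal (schw_metric m) (emb p) = (1 / \<phi>\<^sup>2) *\<^sub>R axis 3 1"
    unfolding unit_normal_def Ginv by (simp add: inner_axis_axis real_sqrt_divide sq)
  have "ric_apply (schw_metric m) (emb p) (unit_normal (schw_metric m) (emb p))
     = ricci (schw_metric m) (emb p) $ 3 $ 3 / \<phi> ^ 4"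
    unfolding ric_apply_def N using \<phi>
    by (simp add: matrix_vector_mult_scaleR inner_axis' matrix_vector_mult_basis column_def eval_nat_numeral)
  moreover have "sqrt (det (induced (schw_metric m) p)) = \<phi> ^ 4"
    unfolding ind by (rule real_sqrt_unique) (auto simp: det_2 mat_def power2_eq_square)
  moreover have "grad2 u p \<bullet> (matrix_inv (induced (schw_metric m) p) *v grad2 u p) = (norm (grad2 u p))\<^sup>2 / \<phi> ^ 4"
    unfolding ind using \<phi>
    by (simp add: matrix_inv_scaled_identity power2_norm_eq_inner flip: scaleR_matrix_vector_assoc)
  ultimately show ?thesis
    using \<phi> by (simp add: ric field_simps)
qed

subsection \<open>Logarithmic polar coordinates\<close>

text \<open>Fubini, transported from \<open>real \<times> real\<close> along the coordinate
  bijection, which maps boxes to boxes and preserves their volume.\<close>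

lemma integral_cbox_vec2:
  fixes f :: "real^2 \<Rightarrow> real"
  assumes "continuous_on (cbox a b) f"
  shows "integral (cbox a b) f =
    integral {a$1..b$1} (\<lambda>x. integral {a$2..b$2} (\<lambda>y. f (vector [x, y])))"
proof -
  let ?g = "\<lambda>(x::real,y::real). vector [x, y] :: real^2"
  let ?h = "\<lambda>v::real^2. (v$1, v$2)"
  have g_eq: "?g = (\<lambda>z. fst z *\<^sub>R axis 1 1 + snd z *\<^sub>R axis 2 1)"
    by (auto simp: vec_eq_iff forall_2 axis_def)
  have img_g: "?g ` cbox u v = cbox (?g u) (?g v)" for u v
  proof -
    have "w \<in> ?g ` cbox u v \<longleftrightarrow> w \<in> cbox (?g u) (?g v)" for w
    proof
      assume "w \<in> cbox (?g u) (?g v)"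
      then show "w \<in> ?g ` cbox u v"
        by (intro image_eqI[of _ _ "?h w"])
          (auto simp: mem_box_cart forall_2 vec_eq_iff cbox_Pair_iff split: prod.splits)
    qed (auto simp: mem_box_cart forall_2 split: prod.splits)
    then show ?thesis by blast
  qed
  have img_h: "?h ` cbox u v = cbox (?h u) (?h v)" for u v
  proof -
    have "z \<in> ?h ` cbox u v \<longleftrightarrow> z \<in> cbox (?h u) (?h v)" for z
    proof
      assume "z \<in> cbox (?h u) (?h v)"
      then show "z \<in> ?h ` cbox u v"
        by (intro image_eqI[of _ _ "?g z"])
          (auto simp: mem_box_cart forall_2 split: prod.splits)
    qed (auto simp: mem_box_cart)
    then show ?thesis by blast
  qed
  have cont: "continuous_on S ?g" for S
    unfolding g_eq by (intro continuous_intros)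
  have "((\<lambda>z. f (?g z)) has_integral (1 / 1) *\<^sub>R integral (cbox a b) f) (?h ` cbox a b)"
  proof (rule has_integral_twiddle)
    show "continuous (at x) ?g" for x
      unfolding g_eq by (intro continuous_intros)
    show "measure lborel (?g ` cbox u v) = 1 * measure lborel (cbox u v)" for u v
    proof (cases u, cases v)
      fix u1 u2 v1 v2 assume uv: "u = (u1, u2)" "v = (v1, v2)"
      have exists_2: "(\<exists>i::2. P i) \<longleftrightarrow> P 1 \<or> P 2" for P
        using forall_2[of "\<lambda>i. \<not> P i"] by blast
      show ?thesis
        unfolding img_g unfolding uv content_Pair
        by (auto simp: content_cbox_if_cart prod_2 content_real_if interval_ne_empty_cart
            interval_eq_empty_cart exists_2 forall_2 UNIV_2)
    qed
    show "(f has_integral integral (cbox a b) f) (cbox a b)"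
      using assms integrable_continuous by blast
  qed (use img_g img_h in \<open>auto simp: vec_eq_iff forall_2\<close>)
  then have "integral (cbox a b) f = integral (cbox (a$1, a$2) (b$1, b$2)) (\<lambda>z. f (?g z))"
    by (simp add: img_h integral_unique)
  also have "\<dots> = integral (cbox (a$1) (b$1)) (\<lambda>x. integral (cbox (a$2) (b$2)) (\<lambda>y. f (?g (x, y))))"
  proof (rule integral_prod_continuous)
    have "?g ` cbox (a$1, a$2) (b$1, b$2) \<subseteq> cbox a b"
      by (auto simp: mem_box_cart forall_2)
    then show "continuous_on (cbox (a$1, a$2) (b$1, b$2)) (\<lambda>z. f (?g z))"
      by (rule continuous_on_compose2[OF assms cont])
  qed
  finally show ?thesis by simp
qed

text \<open>The first coordinate is the \<open>t\<close> of the Jacobi equation, the second one the angle.\<close>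
definition logpolar :: "real \<Rightarrow> real^2 \<Rightarrow> real^2" where
  "logpolar m q = (m / 2 * exp (2 * q$1)) *\<^sub>R (cos (q$2) *\<^sub>R axis 1 1 + sin (q$2) *\<^sub>R axis 2 1)"

definition logpolar' :: "real \<Rightarrow> real^2 \<Rightarrow> real^2 \<Rightarrow> real^2" where
  "logpolar' m q h = (m / 2 * exp (2 * q$1)) *\<^sub>R
    ((2 * h$1 * cos (q$2) - h$2 * sin (q$2)) *\<^sub>R axis 1 1 + (2 * h$1 * sin (q$2) + h$2 * cos (q$2)) *\<^sub>R axis 2 1)"

lemma logpolar_nth [simp]:
  "logpolar m q $ 1 = m / 2 * exp (2 * q$1) * cos (q$2)"
  "logpolar m q $ 2 = m / 2 * exp (2 * q$1) * sin (q$2)"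
  by (simp_all add: logpolar_def axis_def)

lemma norm_vec2: "norm (p :: real^2) = sqrt ((p$1)\<^sup>2 + (p$2)\<^sup>2)"
  by (simp add: norm_vec_def L2_set_def sum_2)

lemma norm_logpolar: "m > 0 \<Longrightarrow> norm (logpolar m q) = m / 2 * exp (2 * q$1)"
proof -
  assume "m > 0"
  have "(m / 2 * exp (2 * q$1) * cos (q$2))\<^sup>2 + (m / 2 * exp (2 * q$1) * sin (q$2))\<^sup>2 = (m / 2 * exp (2 * q$1))\<^sup>2"
    by (simp only: power_mult_distrib distrib_left[symmetric] sin_cos_squared_add2 mult_1_right)
  then show ?thesis
    using \<open>m > 0\<close> by (simp add: norm_vec2)
qed

lemma logpolar_has_derivative:
  "(logpolar m has_derivative logpolar' m q) (at q within S)"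
  unfolding logpolar_def
  apply (rule derivative_eq_intros bounded_linear_imp_has_derivative[OF bounded_linear_vec_nth] refl)+
  by (auto simp: logpolar'_def fun_eq_iff algebra_simps vec_eq_iff axis_def forall_2)

text \<open>The Euclidean area element is \<open>r dr d\<theta>\<close>, and
  \<open>dr = 2 r dt\<close> for \<open>r = (m/2) exp (2 t)\<close>.\<close>

lemma det_logpolar': "det (matrix (logpolar' m q)) = 2 * (m / 2 * exp (2 * q$1))\<^sup>2"
proof -
  have "det (matrix (logpolar' m q)) = 2 * (m / 2 * exp (2 * q$1))\<^sup>2 * ((cos (q$2))\<^sup>2 + (sin (q$2))\<^sup>2)"
    by (simp add: det_2 matrix_def logpolar'_def axis_def power2_eq_square algebra_simps del: sin_cos_squared_add sin_cos_squared_add2 sin_cos_squared_add3)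
  then show ?thesis by simp
qed

text \<open>The norm recovers the first coordinate. The half-open angular range is that of
  \<open>Arg\<close>, so the angle is determined by its sine and cosine.\<close>

lemma inj_on_logpolar:
  assumes "m > 0"
  shows "inj_on (logpolar m) {q. - pi < q$2 \<and> q$2 \<le> pi}"
proof (rule inj_onI)
  fix p q assume p: "p \<in> {q. - pi < q$2 \<and> q$2 \<le> pi}" and q: "q \<in> {q. - pi < q$2 \<and> q$2 \<le> pi}"
    and eq: "logpolar m p = logpolar m q"
  have "p$1 = q$1"
    using arg_cong[OF eq, of norm] assms by (simp add: norm_logpolar)
  moreover have "cos (p$2) = cos (q$2)" "sin (p$2) = sin (q$2)"
    using arg_cong[OF eq, of "\<lambda>x. x$1"] arg_cong[OF eq, of "\<lambda>x. x$2"] assms \<open>p$1 = q$1\<close> by auto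
  then have "cis (p$2) = cis (q$2)" by (simp add: complex_eq_iff)
  then have "p$2 = q$2"
    using p q by (metis (mono_tags, lifting) mem_Collect_eq cis_Arg_unique sgn_cis)
  ultimately show "p = q" by (simp add: vec_eq_iff forall_2)
qed

lemma logpolar_image:
  assumes "m > 0"
  shows "logpolar m ` {q. 0 \<le> q$1 \<and> q$1 \<le> T \<and> - pi < q$2 \<and> q$2 \<le> pi} = Sigma0 m (m / 2 * exp (2 * T))"
    (is "_ ` ?S = _")
proof
  show "logpolar m ` ?S \<subseteq> Sigma0 m (m / 2 * exp (2 * T))"
    using assms by (auto simp: Sigma0_def norm_logpolar)
  show "Sigma0 m (m / 2 * exp (2 * T)) \<subseteq> logpolar m ` ?S"
  proof
    fix p assume p: "p \<in> Sigma0 m (m / 2 * exp (2 * T))"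
    define z where "z = Complex (p$1) (p$2)"
    define q :: "real^2" where "q = vector [ln (2 * norm p / m) / 2, Arg z]"
    have np: "norm p > 0" "m / 2 \<le> norm p" "norm p \<le> m / 2 * exp (2 * T)"
      using p assms by (auto simp: Sigma0_def)
    have z: "norm z = norm p" by (simp add: z_def cmod_def norm_vec2)
    have r: "m / 2 * exp (2 * q$1) = norm p"
      using np assms by (simp add: q_def)
    have "rcis (norm p) (Arg z) = z" using rcis_cmod_Arg[of z] z by simp
    then have "norm p * cos (q$2) = p$1" "norm p * sin (q$2) = p$2"
      unfolding z by (auto simp: q_def complex_eq_iff z_def)
    then have "logpolar m q = p"
      using r by (simp add: vec_eq_iff forall_2)
    moreover have "q \<in> ?S"
    proof -
      have "0 \<le> ln (2 * norm p / m)" using np assms by (simp add: field_simps)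
      moreover have "ln (2 * norm p / m) \<le> ln (exp (2 * T))"
        using np assms by (subst ln_le_cancel_iff) (auto simp: field_simps)
      ultimately show ?thesis
        using Arg_bounded[of z] by (simp add: q_def)
    qed
    ultimately show "p \<in> logpolar m ` ?S" by blast
  qed
qed

text \<open>Injectivity holds on the half-open strip \<open>?S\<close>, while continuity and Fubini
  are used on the closed box \<open>?B\<close>; the two differ by a segment of measure zero.\<close>

lemma integral_Sigma0_logpolar:
  fixes f :: "real^2 \<Rightarrow> real"
  assumes m: "m > 0" and f: "continuous_on (Sigma0 m (m / 2 * exp (2 * T))) f"
  shows "integral (Sigma0 m (m / 2 * exp (2 * T))) f =
    integral {-pi..pi} (\<lambda>\<theta>. integral {0..T} (\<lambda>t.
      2 * (m / 2 * exp (2 * t))\<^sup>2 * f (logpolar m (vector [t, \<theta>]))))"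
proof -
  let ?A = "Sigma0 m (m / 2 * exp (2 * T))"
  let ?S = "{q::real^2. 0 \<le> q$1 \<and> q$1 \<le> T \<and> - pi < q$2 \<and> q$2 \<le> pi}"
  let ?B = "cbox (vector [0, -pi]) (vector [T, pi]) :: (real^2) set"
  let ?F = "\<lambda>q. 2 * (m / 2 * exp (2 * q$1))\<^sup>2 * f (logpolar m q)"
  have "?S = ?B - {q. q$2 = - pi}"
    by (auto simp: mem_box_cart forall_2)
  moreover have neg: "negligible {q::real^2. q$2 = - pi}"
    using negligible_standard_hyperplane[of "axis 2 1 :: real^2" "- pi"]
    by (simp add: cart_eq_inner_axis)
  ultimately have S: "?S \<in> sets lebesgue"
    by (auto intro!: sets.Diff negligible_imp_sets)
  have contF: "continuous_on ?B ?F"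
  proof -
    have "continuous_on ?B (logpolar m)"
      by (rule has_derivative_continuous_on[OF logpolar_has_derivative])
    moreover have "logpolar m ` ?B \<subseteq> ?A"
      using m by (auto simp: mem_box_cart forall_2 Sigma0_def norm_logpolar)
    ultimately have "continuous_on ?B (\<lambda>q. f (logpolar m q))"
      by (rule continuous_on_compose2[OF f])
    then show ?thesis by (intro continuous_intros)
  qed
  have absF: "?F absolutely_integrable_on ?S"
  proof (rule absolutely_integrable_spike_set)
    show "?F absolutely_integrable_on ?B"
      by (rule absolutely_integrable_continuous[OF contF])
    show "negligible {x \<in> ?B - ?S. ?F x \<noteq> 0}"
      by (rule negligible_subset[OF neg]) (auto simp: mem_box_cart forall_2)
    show "negligible {x \<in> ?S - ?B. ?F x \<noteq> 0}"
      by (rule negligible_subset[OF neg]) (auto simp: mem_box_cart forall_2)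
  qed
  \<comment> \<open>The change of variables theorem concerns vector-valued integrands, so
    \<open>f\<close> is regarded as a map into \<open>real^1\<close>.\<close>
  define g :: "real^2 \<Rightarrow> real^1" where "g = vec \<circ> f"
  have eq: "(\<lambda>q. \<bar>det (matrix (logpolar' m q))\<bar> *\<^sub>R g (logpolar m q)) = vec \<circ> ?F"
    by (auto simp: g_def det_logpolar' fun_eq_iff vec_eq_iff)
  have "inj_on (logpolar m) ?S"
    by (rule inj_on_subset[OF inj_on_logpolar[OF m]]) auto
  from has_absolute_integral_change_of_variables[OF S logpolar_has_derivative this,
      of g "integral ?S (vec \<circ> ?F)"]
  have "integral ?S (vec \<circ> ?F :: _ \<Rightarrow> real^1) = integral ?A g"
    using absF unfolding eq logpolar_image[OF m]
    by (simp add: absolutely_integrable_on_1_iff)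
  then have "integral ?A f = integral ?S ?F"
    by (simp add: g_def integral_on_1_eq comp_def vec_eq_iff)
  also have "\<dots> = integral ?B ?F"
    by (rule integral_spike_set; rule negligible_subset[OF neg]) (auto simp: mem_box_cart forall_2)
  also have "\<dots> = integral {0..T} (\<lambda>t. integral {-pi..pi} (\<lambda>\<theta>. ?F (vector [t, \<theta>])))"
    using integral_cbox_vec2[OF contF] by simp
  \<comment> \<open>The order is exchanged so that the inner integral runs along a ray.\<close>
  also have "\<dots> = integral {-pi..pi} (\<lambda>\<theta>. integral {0..T} (\<lambda>t. ?F (vector [t, \<theta>])))"
  proof -
    have "continuous_on (cbox (0, -pi) (T, pi)) (\<lambda>z. ?F (vector [fst z, snd z]))"
    proof (rule continuous_on_compose2[OF contF])
      have "(\<lambda>z::real\<times>real. vector [fst z, snd z] :: real^2) = (\<lambda>z. fst z *\<^sub>R axis 1 1 + snd z *\<^sub>R axis 2 1)"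
        by (auto simp: vec_eq_iff forall_2 axis_def)
      then show "continuous_on (cbox (0, -pi) (T, pi)) (\<lambda>z. vector [fst z, snd z] :: real^2)"
        by (simp only:) (intro continuous_intros)
    qed (auto simp: mem_box_cart forall_2)
    then show ?thesis
      using integral_swap_continuous[of 0 "-pi" T pi "\<lambda>t \<theta>. ?F (vector [t, \<theta>])"]
      by (simp add: case_prod_unfold)
  qed
  finally show ?thesis by simp
qed

subsection \<open>Radial Jacobi functions\<close>

lemma differentiable_imp_grad2:
  assumes "u differentiable (at p)"
  shows "(u has_derivative (\<lambda>h. grad2 u p \<bullet> h)) (at p)"
proof -
  obtain u' where u': "(u has_derivative u') (at p)"
    using assms by (auto simp: differentiable_def)
  have pd: "pd u p i = u' (axis i 1)" for i
    by (rule pd_eqI) (rule has_derivative_imp_line[OF u'])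
  have expand: "u' h = u' (axis 1 1) * h$1 + u' (axis 2 1) * h$2" for h
  proof -
    have "h = h$1 *\<^sub>R axis 1 1 + h$2 *\<^sub>R axis 2 1"
      by (simp add: vec_eq_iff forall_2 axis_def)
    then have "u' h = u' (h$1 *\<^sub>R axis 1 1 + h$2 *\<^sub>R axis 2 1)" by simp
    also have "\<dots> = u' (axis 1 1) * h$1 + u' (axis 2 1) * h$2"
      using has_derivative_linear[OF u'] by (simp add: linear_add linear_cmul)
    finally show ?thesis .
  qed
  have "u' h = grad2 u p \<bullet> h" for h
    by (subst expand) (simp add: grad2_def inner_vec_def sum_2 pd)
  then have "u' = (\<lambda>h. grad2 u p \<bullet> h)" ..
  then show ?thesis using u' by simp
qed

lemma grad2_eqI:
  assumes "(u has_derivative (\<lambda>h. g \<bullet> h)) (at p)"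
  shows "grad2 u p = g"
  unfolding grad2_def
  by (simp add: vec_eq_iff pd_eqI[OF has_derivative_imp_line[OF assms]] inner_axis)

text \<open>An algebra of functions on the punctured plane that contains the unstable test function
  and is closed under partial derivatives, whence all its members are smooth.\<close>
inductive_set radial_algebra :: "real \<Rightarrow> (real^2 \<Rightarrow> real) set" for m :: real where
  const: "(\<lambda>x. a) \<in> radial_algebra m"
| coord: "(\<lambda>x. x $ i) \<in> radial_algebra m"
| norm: "norm \<in> radial_algebra m"
| inv_norm: "(\<lambda>x. 1 / norm x) \<in> radial_algebra m"
| inv_shift: "(\<lambda>x. 1 / (2 * norm x + m)) \<in> radial_algebra m"
| ln_norm: "(\<lambda>x. ln (norm x)) \<in> radial_algebra m"
| add: "f \<in> radial_algebra m \<Longrightarrow> g \<in> radial_algebra m \<Longrightarrow> (\<lambda>x. f x + g x) \<in> radial_algebra m"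
| mult: "f \<in> radial_algebra m \<Longrightarrow> g \<in> radial_algebra m \<Longrightarrow> (\<lambda>x. f x * g x) \<in> radial_algebra m"

lemma radial_algebra_line_derivative:
  assumes "f \<in> radial_algebra m" and m: "m > 0"
  shows "(\<forall>x. x \<noteq> 0 \<longrightarrow> f differentiable (at x)) \<and>
    (\<exists>g\<in>radial_algebra m. \<forall>x. x \<noteq> 0 \<longrightarrow>
       ((\<lambda>t. f (x + t *\<^sub>R axis i 1)) has_real_derivative g x) (at 0))"
  using assms(1)
proof induction
  note ra = radial_algebra.intros
  note nd = norm_has_line_derivative
  have pos: "2 * norm x + m \<noteq> 0" for x :: "real^2"
    using m norm_ge_zero[of x] by linarith
  {
    case (const a)
    show ?case by (auto intro!: bexI[of _ "\<lambda>x. 0"] ra(1))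
  next
    case (coord j)
    have "((\<lambda>t. (x + t *\<^sub>R axis i 1) $ j) has_real_derivative (if i = j then 1 else 0)) (at 0)" for x :: "real^2"
      by (auto intro!: derivative_eq_intros simp: axis_def)
    moreover have "(\<lambda>x. x $ j) differentiable (at x)" for x :: "real^2"
      by (rule bounded_linear_imp_differentiable[OF bounded_linear_vec_nth])
    ultimately show ?case
      by (auto intro!: bexI[of _ "\<lambda>x. if i = j then 1 else 0"] ra(1))
  next
    case norm
    show ?case
    proof (intro conjI bexI allI impI)
      show "(\<lambda>x. x $ i * (1 / norm x)) \<in> radial_algebra m" by (intro ra)
    qed (use nd in \<open>auto intro!: differentiable_norm_at\<close>)
  next
    case inv_norm
    \<comment> \<open>The derivative \<open>- x_i / |x|^3\<close> is spelled as a product of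
      generators, so that membership follows from the introduction rules alone; the next two cases
      do the same.\<close>
    have "((\<lambda>t. 1 / norm (x + t *\<^sub>R axis i 1)) has_real_derivative
        (- 1) * (x $ i * ((1 / norm x) * ((1 / norm x) * (1 / norm x))))) (at 0)" if "x \<noteq> 0" for x :: "real^2"
      using that by (auto intro!: derivative_eq_intros nd)
    moreover have "(\<lambda>x. 1 / norm x) differentiable (at x)" if "x \<noteq> 0" for x :: "real^2"
      using that by (auto intro!: differentiable_divide differentiable_norm_at)
    ultimately show ?case
    proof (intro conjI bexI allI impI)
      show "(\<lambda>x. (- 1) * (x $ i * ((1 / norm x) * ((1 / norm x) * (1 / norm x))))) \<in> radial_algebra m" by (intro ra)
    qed auto
  next
    case inv_shift
    have "((\<lambda>t. 1 / (2 * norm (x + t *\<^sub>R axis i 1) + m)) has_real_derivative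
        (- 2) * (x $ i * ((1 / norm x) * ((1 / (2 * norm x + m)) * (1 / (2 * norm x + m)))))) (at 0)"
      if "x \<noteq> 0" for x :: "real^2"
      using that pos by (auto intro!: derivative_eq_intros nd)
    moreover have "(\<lambda>x. 1 / (2 * norm x + m)) differentiable (at x)" if "x \<noteq> 0" for x :: "real^2"
      using that pos by (auto intro!: differentiable_divide differentiable_add differentiable_mult differentiable_norm_at)
    ultimately show ?case
    proof (intro conjI bexI allI impI)
      show "(\<lambda>x. (- 2) * (x $ i * ((1 / norm x) * ((1 / (2 * norm x + m)) * (1 / (2 * norm x + m)))))) \<in> radial_algebra m" by (intro ra)
    qed auto
  next
    case ln_norm
    have "((\<lambda>t. ln (norm (x + t *\<^sub>R axis i 1))) has_real_derivative
        x $ i * ((1 / norm x) * (1 / norm x))) (at 0)" if "x \<noteq> 0" for x :: "real^2"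
      using that by (auto intro!: derivative_eq_intros nd)
    moreover have "(\<lambda>x. ln (norm x)) differentiable (at x)" if "x \<noteq> 0" for x :: "real^2"
      using that unfolding differentiable_def
      by (auto intro!: exI has_derivative_ln has_derivative_norm)
    ultimately show ?case
    proof (intro conjI bexI allI impI)
      show "(\<lambda>x. x $ i * ((1 / norm x) * (1 / norm x))) \<in> radial_algebra m" by (intro ra)
    qed auto
  next
    case (add f g)
    then obtain f' g' where "f' \<in> radial_algebra m" "g' \<in> radial_algebra m"
      "\<And>x. x \<noteq> 0 \<Longrightarrow> ((\<lambda>t. f (x + t *\<^sub>R axis i 1)) has_real_derivative f' x) (at 0)"
      "\<And>x. x \<noteq> 0 \<Longrightarrow> ((\<lambda>t. g (x + t *\<^sub>R axis i 1)) has_real_derivative g' x) (at 0)"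
      by blast
    with add show ?case
      by (auto intro!: bexI[of _ "\<lambda>x. f' x + g' x"] DERIV_add differentiable_add ra(7))
  next
    case (mult f g)
    then obtain f' g' where *: "f' \<in> radial_algebra m" "g' \<in> radial_algebra m"
      "\<And>x. x \<noteq> 0 \<Longrightarrow> ((\<lambda>t. f (x + t *\<^sub>R axis i 1)) has_real_derivative f' x) (at 0)"
      "\<And>x. x \<noteq> 0 \<Longrightarrow> ((\<lambda>t. g (x + t *\<^sub>R axis i 1)) has_real_derivative g' x) (at 0)"
      by blast
    have "((\<lambda>t. f (x + t *\<^sub>R axis i 1) * g (x + t *\<^sub>R axis i 1)) has_real_derivative
       f' x * g x + g' x * f x) (at 0)" if "x \<noteq> 0" for x
      using DERIV_mult[OF *(3,4)[OF that]] by simp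
    with mult * show ?case
      by (auto intro!: bexI[of _ "\<lambda>x. f' x * g x + g' x * f x"] differentiable_mult ra(7,8))
  }
qed

text \<open>By induction on the list of indices, every iterated partial derivative agrees off the
  origin with a member of the algebra, and members are differentiable there. The punctured plane
  serves as the open neighbourhood of \<open>S\<close>.\<close>

lemma radial_algebra_smooth:
  assumes f: "f \<in> radial_algebra m" "\<And>x. x \<noteq> 0 \<Longrightarrow> u x = f x" and m: "m > 0"
    and S: "0 \<notin> S"
  shows "smooth_on_set S u"
proof -
  have *: "\<exists>g\<in>radial_algebra m. \<forall>x. x \<noteq> 0 \<longrightarrow> iter_pd u is x = g x" for "is"
  proof (induction "is")
    case Nil
    then show ?case using f by auto
  next
    case (Cons i "is")
    then obtain g where g: "g \<in> radial_algebra m" "\<And>x. x \<noteq> 0 \<Longrightarrow> iter_pd u is x = g x"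
      by blast
    obtain g' where g': "g' \<in> radial_algebra m"
      "\<And>x. x \<noteq> 0 \<Longrightarrow> ((\<lambda>t. g (x + t *\<^sub>R axis i 1)) has_real_derivative g' x) (at 0)"
      using radial_algebra_line_derivative[OF g(1) m] by blast
    have "pd (iter_pd u is) x i = g' x" if "x \<noteq> 0" for x
    proof -
      have "pd (iter_pd u is) x i = pd g x i"
        by (rule pd_cong_open[of "- {0}"]) (use that g in auto)
      also have "\<dots> = g' x" using g'(2)[OF that] by (rule pd_eqI)
      finally show ?thesis .
    qed
    then show ?case using g'(1) by auto
  qed
  have "iter_pd u is differentiable_on - {0}" for "is"
  proof -
    obtain g where g: "g \<in> radial_algebra m" "\<And>x. x \<noteq> 0 \<Longrightarrow> iter_pd u is x = g x"
      using * by blast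
    have "g differentiable (at x within - {0})" if "x \<noteq> 0" for x
      using radial_algebra_line_derivative[OF g(1) m] that by (auto intro: differentiable_at_withinI)
    then have "iter_pd u is differentiable (at x within - {0})" if "x \<noteq> 0" for x
      by (rule differentiable_transform_within[of g _ "- {0}" 1]) (use g(2) that in auto)
    then show ?thesis
      by (simp add: differentiable_on_def)
  qed
  then show ?thesis
    unfolding smooth_on_set_def using S by (intro exI[of _ "- {0}"]) auto
qed

text \<open>The destabilising test function, once \<open>c\<close> is chosen so that it vanishes on
  the outer circle.\<close>

definition radial_jacobi :: "real \<Rightarrow> real \<Rightarrow> real^2 \<Rightarrow> real" where
  "radial_jacobi m c p = jacobi_sol c (ln (2 * norm p / m) / 2)"

lemma radial_jacobi_smooth:
  assumes m: "m > 0"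
  shows "smooth_on_set (Sigma0 m R) (radial_jacobi m c)"
proof (rule radial_algebra_smooth[OF _ _ m])
  \<comment> \<open>Here \<open>t = ln (2/m) / 2 + ln |p| / 2\<close> and
    \<open>tanh t = (2 |p| - m) / (2 |p| + m)\<close> are written out in generators of the
    algebra.\<close>
  let ?f = "\<lambda>p::real^2. 1 + ((c - ln (2 / m) / 2) + (- 1 / 2) * ln (norm p)) * ((2 * norm p + - m) * (1 / (2 * norm p + m)))"
  show "?f \<in> radial_algebra m"
    by (intro radial_algebra.intros)
  show "radial_jacobi m c p = ?f p" if "p \<noteq> 0" for p
  proof -
    have "ln (2 * norm p / m) = ln (2 / m) + ln (norm p)"
      using that m by (simp add: ln_div ln_mult)
    moreover have "tanh (ln (2 * norm p / m) / 2) = (2 * norm p - m) / (2 * norm p + m)"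
      using that m by (simp add: tanh_half_ln)
    moreover have "c - (a + b) / 2 = c - a / 2 + (- 1 / 2) * b" for a b :: real
      by (simp add: field_simps)
    ultimately show ?thesis
      by (simp add: radial_jacobi_def jacobi_sol_def)
  qed
  show "0 \<notin> Sigma0 m R" using m by (simp add: Sigma0_def)
qed

lemma grad2_radial_jacobi:
  assumes m: "m > 0" and p: "p \<noteq> 0"
  shows "grad2 (radial_jacobi m c) p =
    (jacobi_sol' c (ln (2 * norm p / m) / 2) / (2 * (norm p)\<^sup>2)) *\<^sub>R p"
proof (rule grad2_eqI)
  have "((\<lambda>p. ln (2 * norm p / m) / 2) has_derivative (\<lambda>h. (p \<bullet> h) / (2 * (norm p)\<^sup>2))) (at p)"
    using m p by (auto intro!: derivative_eq_intros has_derivative_norm simp: fun_eq_iff sgn_div_norm inner_commute divide_simps power2_eq_square)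
  from has_derivative_compose[OF this jacobi_sol_has_derivative[THEN has_field_derivative_imp_has_derivative]]
  show "(radial_jacobi m c has_derivative (\<bullet>) ((jacobi_sol' c (ln (2 * norm p / m) / 2) / (2 * (norm p)\<^sup>2)) *\<^sub>R p)) (at p)"
    by (simp add: radial_jacobi_def[abs_def] inner_scaleR_left[abs_def])
qed

subsection \<open>Stability\<close>

lemma smooth_imp_C1:
  assumes "smooth_on_set S u" "p \<in> S"
  shows "u differentiable (at p)" "isCont (grad2 u) p"
proof -
  obtain U where U: "open U" "S \<subseteq> U" "\<And>is. iter_pd u is differentiable_on U"
    using assms by (auto simp: smooth_on_set_def)
  then have *: "iter_pd u is differentiable (at p)" for "is"
    using assms(2) by (auto simp: differentiable_on_eq_differentiable_at)
  show "u differentiable (at p)" using *[of "[]"] by simp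
  have "isCont (\<lambda>q. pd u q a) p" for a
    using *[of "[a]"] by (auto dest: differentiable_imp_continuous_within)
  then show "isCont (grad2 u) p"
    unfolding grad2_def[abs_def] continuous_within by (intro vec_tendstoI) simp
qed

lemma smooth_imp_continuous_on:
  assumes "smooth_on_set S u"
  shows "continuous_on S u" "continuous_on S (grad2 u)"
  by (intro continuous_at_imp_continuous_on ballI differentiable_imp_continuous_within
      smooth_imp_C1[OF assms], assumption)+

text \<open>The Jacobian \<open>2 r^2\<close> turns the potential into
  \<open>8 m r / (2 r + m)^2\<close>, which is exactly \<open>1 - tanh^2 t\<close>.\<close>

lemma Qform_logpolar:
  assumes m: "m > 0"
    and u: "smooth_on_set (Sigma0 m (m / 2 * exp (2 * T))) u"
  shows "Qform m (m / 2 * exp (2 * T)) u = integral {-pi..pi} (\<lambda>\<theta>. integral {0..T} (\<lambda>t.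
     2 * (m / 2 * exp (2 * t))\<^sup>2 * (norm (grad2 u (logpolar m (vector [t, \<theta>]))))\<^sup>2
     - (1 - tanh t ^ 2) * (u (logpolar m (vector [t, \<theta>])))\<^sup>2))"
proof -
  let ?A = "Sigma0 m (m / 2 * exp (2 * T))"
  let ?f = "\<lambda>p. (norm (grad2 u p))\<^sup>2 - 4 * m / (norm p * (2 * norm p + m)\<^sup>2) * (u p)\<^sup>2"
  have pos: "norm p > 0" "2 * norm p + m > 0" if "p \<in> ?A" for p
    using that m by (auto simp: Sigma0_def)
  have pointwise: "2 * (m / 2 * exp (2 * t))\<^sup>2 * ?f (logpolar m (vector [t, \<theta>])) =
     2 * (m / 2 * exp (2 * t))\<^sup>2 * (norm (grad2 u (logpolar m (vector [t, \<theta>]))))\<^sup>2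
     - (1 - tanh t ^ 2) * (u (logpolar m (vector [t, \<theta>])))\<^sup>2" for t \<theta>
  proof -
    define r where "r = m / 2 * exp (2 * t)"
    have r: "r > 0" using m by (simp add: r_def)
    have "ln (2 * r / m) / 2 = t" using m by (simp add: r_def)
    with tanh_half_ln[OF m r] have "tanh t = (2 * r - m) / (2 * r + m)" by simp
    then have "1 - tanh t ^ 2 = ((2 * r + m)\<^sup>2 - (2 * r - m)\<^sup>2) / (2 * r + m)\<^sup>2"
      using m r by (simp add: power_divide) (simp add: divide_simps)
    also have "(2 * r + m)\<^sup>2 - (2 * r - m)\<^sup>2 = 2 * r\<^sup>2 * (4 * m) / r"
      using r by (simp add: power2_eq_square algebra_simps)
    finally have "2 * r\<^sup>2 * (4 * m / (r * (2 * r + m)\<^sup>2)) = 1 - tanh t ^ 2" by simp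
    moreover have "norm (logpolar m (vector [t, \<theta>])) = r"
      using m by (simp add: norm_logpolar r_def)
    ultimately show ?thesis
      by (simp only: right_diff_distrib mult.assoc[symmetric] flip: r_def)
  qed
  have "Qform m (m / 2 * exp (2 * T)) u = integral ?A ?f"
    unfolding Qform_def
  proof (rule integral_cong)
    fix p assume "p \<in> ?A"
    with pos show "(grad2 u p \<bullet> (matrix_inv (induced (schw_metric m) p) *v grad2 u p)
         - ric_apply (schw_metric m) (emb p) (unit_normal (schw_metric m) (emb p)) * (u p)^2)
        * sqrt (det (induced (schw_metric m) p)) = ?f p"
      by (intro Qform_integrand m) auto
  qed
  also have "\<dots> = integral {-pi..pi} (\<lambda>\<theta>. integral {0..T} (\<lambda>t.
      2 * (m / 2 * exp (2 * t))\<^sup>2 * ?f (logpolar m (vector [t, \<theta>]))))"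
  proof (rule integral_Sigma0_logpolar[OF m])
    show "continuous_on ?A ?f"
      using pos by (intro continuous_intros smooth_imp_continuous_on[OF u]) (auto simp: less_imp_neq[symmetric])
  qed
  also have "\<dots> = integral {-pi..pi} (\<lambda>\<theta>. integral {0..T} (\<lambda>t.
     2 * (m / 2 * exp (2 * t))\<^sup>2 * (norm (grad2 u (logpolar m (vector [t, \<theta>]))))\<^sup>2
     - (1 - tanh t ^ 2) * (u (logpolar m (vector [t, \<theta>])))\<^sup>2))"
    unfolding pointwise ..
  finally show ?thesis .
qed

lemma logpolar_ray_derivative:
  "((\<lambda>t. logpolar m (vector [t, \<theta>])) has_vector_derivative 2 *\<^sub>R logpolar m (vector [t, \<theta>])) (at t within S)"
  unfolding logpolar_def
  by (auto intro!: derivative_eq_intros simp: has_vector_derivative_def fun_eq_iff algebra_simps)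

lemma smooth_form_nonneg:
  assumes m: "m > 0" and T: "0 < T" "T * tanh T \<le> 1"
    and u: "smooth_on_set (Sigma0 m (m / 2 * exp (2 * T))) u"
    and u0: "\<And>p. norm p = m / 2 * exp (2 * T) \<Longrightarrow> u p = 0"
  shows "0 \<le> Qform m (m / 2 * exp (2 * T)) u"
proof -
  let ?A = "Sigma0 m (m / 2 * exp (2 * T))"
  note contu = smooth_imp_continuous_on(1)[OF u] and contdu = smooth_imp_continuous_on(2)[OF u]
  have "0 \<le> integral {0..T} (\<lambda>t.
     2 * (m / 2 * exp (2 * t))\<^sup>2 * (norm (grad2 u (logpolar m (vector [t, \<theta>]))))\<^sup>2
     - (1 - tanh t ^ 2) * (u (logpolar m (vector [t, \<theta>])))\<^sup>2)" (is "0 \<le> integral _ ?F") for \<theta>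
  proof -
    define P where "P t = logpolar m (vector [t, \<theta>])" for t
    have P: "P t \<in> ?A" "norm (P t) = m / 2 * exp (2 * t)" if "t \<in> {0..T}" for t
      using that m by (auto simp: P_def Sigma0_def norm_logpolar)
    have dP: "(P has_vector_derivative 2 *\<^sub>R P t) (at t within S)" for t S
      unfolding P_def[abs_def] by (rule logpolar_ray_derivative)
    have contP: "continuous_on {0..T} P"
      using dP by (auto simp: continuous_on_eq_continuous_within intro: has_vector_derivative_continuous)
    let ?v' = "\<lambda>t. grad2 u (P t) \<bullet> (2 *\<^sub>R P t)"
    let ?G = "\<lambda>t. (?v' t)\<^sup>2 - 2 * (1 - tanh t ^ 2) * (u (P t))\<^sup>2"
    have conts: "continuous_on {0..T} (\<lambda>t. u (P t))" "continuous_on {0..T} (\<lambda>t. grad2 u (P t))"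
      using P(1) by (auto intro!: continuous_on_compose2[OF contu contP] continuous_on_compose2[OF contdu contP])
    have "0 \<le> integral {0..T} ?G"
    proof (rule ray_form_nonneg[OF T])
      fix t assume t: "t \<in> {0..T}"
      have "(u has_derivative (\<bullet>) (grad2 u (P t))) (at (P t))"
        by (rule differentiable_imp_grad2[OF smooth_imp_C1(1)[OF u P(1)[OF t]]])
      from vector_derivative_diff_chain_within[OF dP has_derivative_at_withinI[OF this]]
      show "((\<lambda>t. u (P t)) has_real_derivative ?v' t) (at t within {0..T})"
        by (simp add: has_real_derivative_iff_has_vector_derivative comp_def)
    next
      show "continuous_on {0..T} ?v'"
        by (intro continuous_intros conts contP)
      show "u (P T) = 0" using P(2)[of T] T u0 by auto
    qed
    then have "0 \<le> integral {0..T} (\<lambda>t. (1/2) * ?G t)" by simp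
    also have "\<dots> \<le> integral {0..T} ?F"
    proof (rule integral_le)
      show "(\<lambda>t. (1/2) * ?G t) integrable_on {0..T}"
        by (intro integrable_continuous_real continuous_intros conts contP) auto
      show "?F integrable_on {0..T}"
        unfolding P_def[symmetric]
        by (intro integrable_continuous_real continuous_intros conts contP) auto
      fix t assume t: "t \<in> {0..T}"
      \<comment> \<open>Only the radial part of the gradient enters \<open>?v'\<close>.
        Cauchy-Schwarz bounds half its square by the weighted Dirichlet term, discarding the angular
        energy.\<close>
      have "\<bar>?v' t\<bar> \<le> norm (grad2 u (P t)) * (2 * norm (P t))"
        using Cauchy_Schwarz_ineq2[of "grad2 u (P t)" "2 *\<^sub>R P t"] by simp
      then have "(?v' t)\<^sup>2 \<le> (norm (grad2 u (P t)) * (2 * norm (P t)))\<^sup>2"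
        by (rule abs_le_square_iff[THEN iffD1, OF order_trans[OF _ abs_ge_self]])
      then show "(1/2) * ?G t \<le> ?F t"
        unfolding P_def[symmetric] P(2)[OF t, symmetric]
        by (simp add: power_mult_distrib algebra_simps)
    qed
    finally show ?thesis .
  qed
  \<comment> \<open>If the ray integrals were not integrable in the angle, the outer integral would
    be 0 by default, so it is nonnegative in either case.\<close>
  then show ?thesis
    unfolding Qform_logpolar[OF m u]
    by (cases "(\<lambda>\<theta>. integral {0..T} (\<lambda>t.
     2 * (m / 2 * exp (2 * t))\<^sup>2 * (norm (grad2 u (logpolar m (vector [t, \<theta>]))))\<^sup>2
     - (1 - tanh t ^ 2) * (u (logpolar m (vector [t, \<theta>])))\<^sup>2)) integrable_on {-pi..pi}")
      (auto intro: integral_nonneg simp: not_integrable_integral)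
qed

text \<open>For a radial function the Cauchy-Schwarz step is an equality, so each ray contributes
  \<open>- c / 2\<close> and the total is \<open>- pi * c\<close>.\<close>

lemma radial_jacobi_form_neg:
  assumes m: "m > 0" and T: "0 < T" and c: "c > 0" "jacobi_sol c T = 0"
  shows "Qform m (m / 2 * exp (2 * T)) (radial_jacobi m c) < 0"
proof -
  let ?u = "radial_jacobi m c"
  have ray: "2 * (m / 2 * exp (2 * t))\<^sup>2 * (norm (grad2 ?u (logpolar m (vector [t, \<theta>]))))\<^sup>2
     - (1 - tanh t ^ 2) * (?u (logpolar m (vector [t, \<theta>])))\<^sup>2
     = (1/2) * ((jacobi_sol' c t)\<^sup>2 - 2 * (1 - tanh t ^ 2) * (jacobi_sol c t)\<^sup>2)" for t \<theta>
  proof -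
    define r where "r = m / 2 * exp (2 * t)"
    define P where "P = logpolar m (vector [t, \<theta>])"
    have r: "r > 0" using m by (simp add: r_def)
    have t: "ln (2 * r / m) / 2 = t" using m by (simp add: r_def)
    have P: "norm P = r" using m by (simp add: norm_logpolar r_def P_def)
    with r have "P \<noteq> 0" by auto
    then have "grad2 ?u P = (jacobi_sol' c t / (2 * r\<^sup>2)) *\<^sub>R P"
      using grad2_radial_jacobi[OF m] P t by simp
    then have "norm (grad2 ?u P) = \<bar>jacobi_sol' c t\<bar> / (2 * r)"
      using P r by (simp add: power2_eq_square)
    then have "2 * r\<^sup>2 * (norm (grad2 ?u P))\<^sup>2 = (1/2) * (jacobi_sol' c t)\<^sup>2"
      using r by (simp add: power_divide power_mult_distrib)
    moreover have "?u P = jacobi_sol c t" using P t by (simp add: radial_jacobi_def)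
    ultimately show ?thesis
      unfolding r_def[symmetric] P_def[symmetric] by (simp add: algebra_simps)
  qed
  have "integral {0..T} (\<lambda>t. (1/2) * ((jacobi_sol' c t)\<^sup>2 - 2 * (1 - tanh t ^ 2) * (jacobi_sol c t)\<^sup>2))
      = - c / 2"
    using integral_unique[OF has_integral_mult_right[OF jacobi_sol_form[OF T c(2)], of "1/2"]] by simp
  then have "Qform m (m / 2 * exp (2 * T)) ?u = integral {-pi..pi} (\<lambda>\<theta>. - c / 2)"
    unfolding Qform_logpolar[OF m radial_jacobi_smooth[OF m]] ray by (rule arg_cong)
  also have "\<dots> < 0" using c by simp
  finally show ?thesis .
qed

lemma stable_iff:
  assumes m: "m > 0" and R: "R > m / 2"
  defines "T \<equiv> ln (sqrt (2 * R / m))"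
  shows "stable m R \<longleftrightarrow> T * tanh T \<le> 1"
proof -
  have T: "T > 0" using m R by (simp add: T_def)
  have Teq: "T = ln (2 * R / m) / 2" using m R by (simp add: T_def ln_sqrt)
  have RT: "R = m / 2 * exp (2 * T)" using m R unfolding Teq by simp
  show ?thesis
  proof
    assume "T * tanh T \<le> 1"
    then show "stable m R"
      unfolding stable_def using smooth_form_nonneg[OF m T, folded RT] by blast
  next
    assume st: "stable m R"
    show "T * tanh T \<le> 1"
    proof (rule ccontr)
      assume *: "\<not> T * tanh T \<le> 1"
      \<comment> \<open>This is the solution of \<open>1 + (c - T) tanh T = 0\<close>; it is
        positive because \<open>T tanh T > 1\<close>.\<close>
      define c where "c = T - 1 / tanh T"
      have "tanh T > 0" using T by simp
      with * have c: "c > 0" "jacobi_sol c T = 0"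
        by (simp_all add: c_def jacobi_sol_def field_simps)
      then have "Qform m R (radial_jacobi m c) < 0"
        using radial_jacobi_form_neg[OF m T, folded RT] by blast
      moreover have "radial_jacobi m c p = 0" if "norm p = R" for p
        using that c Teq by (simp add: radial_jacobi_def)
      ultimately show False
        using st radial_jacobi_smooth[OF m] unfolding stable_def by force
    qed
  qed
qed

theorem theorem1p2:
  fixes m :: real
  assumes "m > 0"
  shows "(\<exists>!Rs. Rs > m / 2 \<and> ln (sqrt (2 * Rs / m)) = (2 * Rs + m) / (2 * Rs - m))
       \<and> (\<forall>Rs. Rs > m / 2 \<and> ln (sqrt (2 * Rs / m)) = (2 * Rs + m) / (2 * Rs - m) \<longrightarrow>
              (\<forall>R. R > m / 2 \<longrightarrow> (stable m R \<longleftrightarrow> R \<le> Rs)))"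
proof -
  let ?\<tau> = "\<lambda>R. ln (sqrt (2 * R / m))"
  have crit: "Rs > m / 2 \<and> ?\<tau> Rs = (2 * Rs + m) / (2 * Rs - m) \<longleftrightarrow>
      Rs > m / 2 \<and> ?\<tau> Rs * tanh (?\<tau> Rs) = 1" for Rs
    using critical_radius_iff[OF assms] by blast
  \<comment> \<open>The stability quantity increases strictly with the radius. Hence it takes the
    value 1 at most once, and it is at most 1 precisely up to that radius.\<close>
  have mono: "?\<tau> R * tanh (?\<tau> R) < ?\<tau> R' * tanh (?\<tau> R')" if "m / 2 < R" "R < R'" for R R'
    using that assms by (intro x_tanh_strict_mono) (auto simp: divide_strict_right_mono)
  obtain t :: real where t: "t > 0" "t * tanh t = 1"
    using ex_x_tanh_eq_1 by blast
  have "?\<tau> (m / 2 * exp (2 * t)) = t"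
    using assms by (simp add: ln_sqrt)
  then have "\<exists>Rs. Rs > m / 2 \<and> ?\<tau> Rs * tanh (?\<tau> Rs) = 1"
    using t assms by (intro exI[of _ "m / 2 * exp (2 * t)"]) auto
  then have "\<exists>!Rs. Rs > m / 2 \<and> ?\<tau> Rs * tanh (?\<tau> Rs) = 1"
    by (metis less_irrefl linorder_cases mono)
  moreover have "stable m R \<longleftrightarrow> R \<le> Rs"
    if "Rs > m / 2" "?\<tau> Rs * tanh (?\<tau> Rs) = 1" "R > m / 2" for R Rs
    unfolding stable_iff[OF assms that(3)]
    using mono[of R Rs] mono[of Rs R] that by (cases R Rs rule: linorder_cases) auto
  ultimately show ?thesis
    unfolding crit by blast
qed

end
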